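(* (a) The polynomials $Q_n(Z)$ satisfy $Q_0(Z)=0$, $Q_1(Z)=1$, and for $n\geq 2$, $$Q_n(Z)=W_1(Z)\cdot Q_{n-1}(Z) - W_2(Z)\cdot Q_{n-2}(Z).$$ (b) The polynomials $R_n(Z)$ satisfy $R_0(Z)=1$, $R_1(Z)=w+x+y$, and for $n\geq 2$, $$R_n(Z)=W_1(Z)\cdot R_{n-1}(Z) - W_2(Z)\cdot R_{n-2}(Z).$$
   Context: Let $Z=(w,x,y,z)$ be a quadruple of variables. The polynomials $S(n;Z)$, $n\ge 0$, are defined by the generating function $$\sum_{n=0}^{\infty}S(n;Z)q^n = \prod_{j=0}^{\infty}\left(1+wq^{3^j}\right)\left(1+xq^{3^j}\right)\left(1+yq^{3^j}+zq^{2\cdot 3^j}\right),$$ with the convention $S(-1;Z)=0$. For $n\ge 0$ define $$Q_n(Z):=S(\tfrac{3^n-3}{2};Z),\qquad R_n(Z):=S(\tfrac{3^n-1}{2};Z).$$ Further, $$W_1(Z):=wxy+wz+xz+w+x+y,$$ $$W_2(Z):=w^2xy+w^2z+wx^2y+wxy^2+wxz+wyz+x^2z+xyz.$$ *)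

theory Defs
  imports
    "HOL-Analysis.Infinite_Products"
    "HOL-Computational_Algebra.Formal_Power_Series"
    "HOL-Library.Poly_Mapping"
begin

text \<open>The polynomial ring over the integers in four variables: a polynomial is a finitely
  supported map from exponent vectors to coefficients.\<close>

datatype var = Var_w | Var_x | Var_y | Var_z

type_synonym polyZ = "(var \<Rightarrow>\<^sub>0 nat) \<Rightarrow>\<^sub>0 int"

definition Var :: "var \<Rightarrow> polyZ" where
  "Var v = Poly_Mapping.single (Poly_Mapping.single v 1) 1"

abbreviation w :: polyZ where "w \<equiv> Var Var_w"
abbreviation x :: polyZ where "x \<equiv> Var Var_x"
abbreviation y :: polyZ where "y \<equiv> Var Var_y"
abbreviation z :: polyZ where "z \<equiv> Var Var_z"

definition factor :: "nat \<Rightarrow> polyZ fps" where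
  "factor j =
     (1 + fps_const w * fps_X ^ (3 ^ j)) *
     (1 + fps_const x * fps_X ^ (3 ^ j)) *
     (1 + fps_const y * fps_X ^ (3 ^ j) + fps_const z * fps_X ^ (2 * 3 ^ j))"

text \<open>The infinite product is taken with respect to the usual topology of formal power series
  (eventual constancy of every coefficient); it converges by \<open>factor_has_prod\<close> below.\<close>

definition S_gf :: "polyZ fps" where
  "S_gf = prodinf factor"

text \<open>The index is an integer because of the convention \<open>S (- 1) = 0\<close>; other negative
  indices do not occur.\<close>

definition S :: "int \<Rightarrow> polyZ" where
  "S n = (if n < 0 then 0 else fps_nth S_gf (nat n))"

text \<open>Both divisions are exact, and for \<open>n = 0\<close> the index in \<open>Q\<close> is \<open>- 1\<close>.\<close>

definition Q :: "nat \<Rightarrow> polyZ" where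
  "Q n = S ((3 ^ n - 3) div 2)"

definition R :: "nat \<Rightarrow> polyZ" where
  "R n = S ((3 ^ n - 1) div 2)"

definition W1 :: polyZ where
  "W1 = w * x * y + w * z + x * z + w + x + y"

definition W2 :: polyZ where
  "W2 = w^2 * x * y + w^2 * z + w * x^2 * y + w * x * y^2 + w * x * z + w * y * z
        + x^2 * z + x * y * z"

lemma fps_nth_factor_prod_stable:
  assumes "n < 3 ^ k" "k \<le> m"
  shows "fps_nth (\<Prod>j<m. factor j) n = fps_nth (\<Prod>j<k. factor j) n"
  using assms(2)
proof (induction m rule: dec_induct)
  case (step m)
  let ?a = "fps_const w" and ?b = "fps_const x" and ?c = "fps_const y" and ?d = "fps_const z"
  let ?t = "fps_X ^ (3 ^ m) :: polyZ fps"
  define P where "P = (\<Prod>j<m. factor j)"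
  define H where "H = ?a + (1 + ?a * ?t) * ?b
     + (1 + ?a * ?t) * (1 + ?b * ?t) * (?c + ?d * ?t)"
  have "n < 3 ^ m"
    using assms(1) step.hyps(1) by (meson less_le_trans one_le_numeral power_increasing)
  have "factor m = 1 + ?t * H"
    by (simp add: factor_def H_def algebra_simps mult_2 power_add)
  then have "(\<Prod>j<Suc m. factor j) = P + ?t * (P * H)"
    by (simp add: P_def algebra_simps)
  then have "fps_nth (\<Prod>j<Suc m. factor j) n = fps_nth P n"
    using \<open>n < 3 ^ m\<close> by (simp add: fps_X_power_mult_nth)
  then show ?case
    using step.IH by (simp add: P_def)
qed simp

lemma factor_has_prod: "factor has_prod S_gf"
proof -
  define G where "G = Abs_fps (\<lambda>n. fps_nth (\<Prod>j<n. factor j) n)"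
  have less: "n < 3 ^ n" for n :: nat
    by (induction n) auto
  have lim: "(\<lambda>m. \<Prod>j\<le>m. factor j) \<longlonglongrightarrow> G"
  proof (rule tendsto_fpsI)
    fix n
    show "\<forall>\<^sub>F m in sequentially. fps_nth (\<Prod>j\<le>m. factor j) n = fps_nth G n"
      using eventually_ge_at_top[of n]
    proof eventually_elim
      case (elim m)
      then show ?case
        using fps_nth_factor_prod_stable[of n n "Suc m", OF less]
        by (simp add: G_def lessThan_Suc_atMost)
    qed
  qed
  have ne: "factor j \<noteq> 0" for j
  proof -
    have "fps_nth (factor j) 0 = 1"
      by (simp add: factor_def fps_X_power_nth)
    then show ?thesis
      by auto
  qed
  have "fps_nth G 0 = 1"
    by (simp add: G_def)
  then have "G \<noteq> 0"
    by auto
  with lim have G: "factor has_prod G"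
    by (simp add: has_prod_def raw_has_prod_def)
  have "H = G" if "factor has_prod H" for H
    using that ne lim LIMSEQ_unique by (auto simp: has_prod_def raw_has_prod_def)
  with G have "prodinf factor = G"
    unfolding prodinf_def by (rule the_equality)
  with G show ?thesis
    by (simp add: S_gf_def)
qed

end

theory Submission
  imports Defs
begin

text \<open>
  The \<open>j\<close>-th factor of the product is the zeroth one with \<open>q\<close> replaced by \<open>q ^ 3 ^ j\<close>, so the
  generating function \<open>F\<close> satisfies \<open>F(q) = p(q) * F(q ^ 3)\<close>, where \<open>p\<close> is the zeroth factor
  (\<open>S_gf_functional_equation\<close>).  It has degree 4; write \<open>p = 1 + c1 q + c2 q\<^sup>2 + c3 q\<^sup>3 + c4 q\<^sup>4\<close>.
  Sorting by residues modulo 3 gives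
    \<open>S (3 k) = S k + c3 * S (k - 1)\<close> and \<open>S (3 k + 1) = c1 * S k + c4 * S (k - 1)\<close>.

  Put \<open>k = (3 ^ n - 1) / 2\<close>.  Then \<open>R n = S k\<close> and \<open>Q n = S (k - 1)\<close>, while \<open>3 k + 1\<close> and \<open>3 k\<close> are
  the indices of \<open>R (n + 1)\<close> and \<open>Q (n + 1)\<close>.  Hence the pair \<open>(Q n, R n)\<close> is multiplied at each
  step by a fixed 2-by-2 matrix, whose rows are \<open>(c3, 1)\<close> and \<open>(c4, c1)\<close>.  Its trace \<open>c1 + c3\<close> is
  \<open>W1\<close> and its determinant \<open>c1 * c3 - c4\<close> is \<open>W2\<close>, so by the Cayley--Hamilton theorem
  both coordinates satisfy the stated recurrence.
\<close>

lemma fps_compose_X_power_nth: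
  fixes f :: "'a::comm_ring_1 fps"
  assumes "m > 0"
  shows "fps_nth (f oo fps_X ^ m) n = (if m dvd n then fps_nth f (n div m) else 0)"
proof -
  have "fps_nth (f oo fps_X ^ m) n = (\<Sum>i=0..n. if n = m * i then fps_nth f i else 0)"
    by (simp add: fps_compose_nth fps_X_power_nth power_mult [symmetric] if_distrib cong: if_cong)
  also have "\<dots> = (\<Sum>i=0..n. if i = n div m then (if m dvd n then fps_nth f i else 0) else 0)"
    using assms by (intro sum.cong refl) auto
  also have "\<dots> = (if m dvd n then fps_nth f (n div m) else 0)"
    by (simp add: sum.delta)
  finally show ?thesis .
qed

text \<open>Every factor of the product is built from constants and powers of \<open>q\<close>, so the two laws
  below suffice to carry it through the substitution \<open>q \<mapsto> q ^ 3\<close>.  The general law for composing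
  a product is stated for integral domains, and would require a proof that \<open>polyZ\<close> is one.\<close>

lemma fps_compose_const_mult:
  fixes f :: "'a::comm_ring_1 fps"
  shows "(fps_const c * f) oo g = fps_const c * (f oo g)"
  by (simp add: fps_eq_iff fps_compose_nth sum_distrib_left mult.assoc)

lemma fps_compose_X_power_mult:
  fixes f :: "'a::comm_ring_1 fps"
  assumes "m > 0"
  shows "(fps_X ^ k * f) oo fps_X ^ m = fps_X ^ (m * k) * (f oo fps_X ^ m)"
proof (rule fps_ext)
  fix n
  show "fps_nth ((fps_X ^ k * f) oo fps_X ^ m) n = fps_nth (fps_X ^ (m * k) * (f oo fps_X ^ m)) n"
  proof (cases "n < m * k")
    case True
    then have "n div m < k"
      by (simp add: assms less_mult_imp_div_less mult.commute)
    with True show ?thesis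
      using assms by (simp add: fps_compose_X_power_nth fps_X_power_mult_nth)
  next
    case False
    then obtain d where "n = m * k + d"
      by (metis le_add_diff_inverse not_less)
    then show ?thesis
      using assms by (simp add: fps_compose_X_power_nth fps_X_power_mult_nth dvd_add_right_iff)
  qed
qed

lemma factor_Suc_mult_compose:
  "factor (Suc j) * (f oo fps_X ^ 3) = (factor j * f) oo fps_X ^ 3"
proof -
  have lin: "((1 + fps_const a * fps_X ^ k) * g) oo fps_X ^ 3 =
      (1 + fps_const a * fps_X ^ (3 * k)) * (g oo fps_X ^ 3)" for a k and g :: "polyZ fps"
    by (simp add: distrib_right fps_compose_add_distrib mult.assoc
        fps_compose_const_mult fps_compose_X_power_mult)
  have quad: "((1 + fps_const a * fps_X ^ k + fps_const b * fps_X ^ l) * g) oo fps_X ^ 3 =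
      (1 + fps_const a * fps_X ^ (3 * k) + fps_const b * fps_X ^ (3 * l)) * (g oo fps_X ^ 3)"
    for a b k l and g :: "polyZ fps"
    by (simp add: distrib_right fps_compose_add_distrib mult.assoc
        fps_compose_const_mult fps_compose_X_power_mult)
  have "3 * (2 * 3 ^ j) = (2 * 3 ^ Suc j :: nat)"
    by simp
  then show ?thesis
    unfolding factor_def mult.assoc lin quad by simp
qed

lemma prod_factor_Suc:
  "(\<Prod>j<Suc k. factor j) = factor 0 * ((\<Prod>j<k. factor j) oo fps_X ^ 3)"
proof (induction k)
  case (Suc k)
  have "(\<Prod>j<Suc (Suc k). factor j) = factor 0 * (factor (Suc k) * ((\<Prod>j<k. factor j) oo fps_X ^ 3))"
    by (subst prod.lessThan_Suc, subst Suc.IH) (simp only: mult_ac)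
  then show ?case
    by (simp only: factor_Suc_mult_compose prod.lessThan_Suc mult.commute)
qed simp

lemma S_gf_nth:
  assumes "n < 3 ^ k"
  shows "fps_nth S_gf n = fps_nth (\<Prod>j<k. factor j) n"
proof -
  have "fps_nth (factor j) 0 = 1" for j
    by (simp add: factor_def fps_X_power_nth)
  then have "factor j \<noteq> 0" for j
    by (auto simp: fps_nonzero_nth intro!: exI [of _ 0])
  \<comment> \<open>As no factor vanishes, the value of the infinite product is the limit of the partial
    products starting at index 0.\<close>
  then have "(\<lambda>m. \<Prod>j\<le>m. factor j) \<longlonglongrightarrow> S_gf"
    using factor_has_prod by (simp add: has_prod_def raw_has_prod_def)
  then have "\<forall>\<^sub>F m in sequentially. fps_nth (\<Prod>j\<le>m. factor j) n = fps_nth S_gf n"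
    by (simp add: tendsto_fps_iff)
  then have "\<forall>\<^sub>F m in sequentially. m \<ge> k \<and> fps_nth (\<Prod>j\<le>m. factor j) n = fps_nth S_gf n"
    by (intro eventually_conj eventually_ge_at_top)
  then obtain m where "m \<ge> k" "fps_nth (\<Prod>j\<le>m. factor j) n = fps_nth S_gf n"
    using eventually_happens' [OF sequentially_bot] by blast
  then show ?thesis
    using fps_nth_factor_prod_stable [OF assms, of "Suc m"] by (simp add: lessThan_Suc_atMost)
qed

text \<open>Passing to the limit in \<open>prod_factor_Suc\<close>: the \<open>j\<close>-th
  factor is 1 up to order \<open>3 ^ j\<close>, so only factors with \<open>3 ^ j \<le> n\<close> contribute to the coefficient
  of \<open>q ^ n\<close>, and the finite identity with \<open>k = n\<close> already determines it.\<close>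

lemma S_gf_functional_equation: "S_gf = factor 0 * (S_gf oo fps_X ^ 3)"
proof (rule fps_ext)
  fix n
  have less: "n < 3 ^ n" for n :: nat
    by (induction n) auto
  have "fps_nth ((\<Prod>j<n. factor j) oo fps_X ^ 3) i = fps_nth (S_gf oo fps_X ^ 3) i" if "i \<le> n" for i
  proof -
    have "i div 3 < 3 ^ n"
      using that less [of n] by (meson div_le_dividend le_less_trans)
    then show ?thesis
      by (simp add: fps_compose_X_power_nth S_gf_nth)
  qed
  then have "fps_nth (factor 0 * ((\<Prod>j<n. factor j) oo fps_X ^ 3)) n =
      fps_nth (factor 0 * (S_gf oo fps_X ^ 3)) n"
    by (simp add: fps_mult_nth)
  moreover have "n < 3 ^ Suc n"
    using less [of n] by simp
  ultimately show "fps_nth S_gf n = fps_nth (factor 0 * (S_gf oo fps_X ^ 3)) n"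
    by (metis S_gf_nth prod_factor_Suc)
qed

lemma factor_0_expand:
  "factor 0 = 1 + fps_const (w + x + y) * fps_X ^ 1 + fps_const (w * x + w * y + x * y + z) * fps_X ^ 2
     + fps_const (w * x * y + w * z + x * z) * fps_X ^ 3 + fps_const (w * x * z) * fps_X ^ 4"
  by (simp add: factor_def algebra_simps eval_nat_numeral
      fps_const_add [symmetric] fps_const_mult [symmetric] del: fps_const_add fps_const_mult)

text \<open>This is the functional equation read off at one coefficient, where \<open>T\<close> lists the
  coefficients of \<open>F(q ^ 3)\<close>.  Because \<open>S\<close> vanishes at negative indices, it holds at every
  integer, which covers the lower boundary indices as well.\<close>

lemma S_functional_equation:
  fixes m :: int
  defines "T \<equiv> \<lambda>i. if 3 dvd i then S (i div 3) else 0"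
  shows "S m = T m + (w + x + y) * T (m - 1) + (w * x + w * y + x * y + z) * T (m - 2)
    + (w * x * y + w * z + x * z) * T (m - 3) + w * x * z * T (m - 4)"
proof (cases "m < 0")
  case True
  have "T i = 0" if "i < 0" for i
    using that by (simp add: T_def S_def pos_imp_zdiv_neg_iff)
  with True show ?thesis
    by (simp add: S_def)
next
  case False
  then obtain n where m: "m = int n"
    by (metis nonneg_int_cases not_less)
  have shifted: "fps_nth (fps_X ^ i * (S_gf oo fps_X ^ 3)) n = T (int n - int i)" for i
  proof (cases "n < i")
    case True
    then show ?thesis
      by (simp add: T_def S_def fps_X_power_mult_nth)
  next
    case False
    then obtain d where "n = i + d"
      by (metis le_add_diff_inverse not_less)
    moreover have "3 dvd int d \<longleftrightarrow> 3 dvd d" "\<not> int d div 3 < 0"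
      by presburger+
    ultimately show ?thesis
      by (simp add: T_def S_def fps_X_power_mult_nth fps_compose_X_power_nth nat_div_distrib)
  qed
  have "S m = fps_nth (factor 0 * (S_gf oo fps_X ^ 3)) n"
    by (simp add: S_def m flip: S_gf_functional_equation)
  also have "\<dots> = T m + (w + x + y) * T (m - 1) + (w * x + w * y + x * y + z) * T (m - 2)
      + (w * x * y + w * z + x * z) * T (m - 3) + w * x * z * T (m - 4)"
    using shifted [of 0] shifted [of 1] shifted [of 2] shifted [of 3] shifted [of 4]
    by (simp add: factor_0_expand distrib_right mult.assoc m del: power_one_right power_Suc)
  finally show ?thesis .
qed

lemma S_triple: "S (3 * k) = S k + (w * x * y + w * z + x * z) * S (k - 1)"
proof -
  have "\<not> 3 dvd 3 * k - 1" "\<not> 3 dvd 3 * k - 2" "3 dvd 3 * k - 3" "\<not> 3 dvd 3 * k - 4"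
    and "(3 * k - 3) div 3 = k - 1"
    by presburger+
  then show ?thesis
    by (subst S_functional_equation) simp
qed

lemma S_triple_plus_1: "S (3 * k + 1) = (w + x + y) * S k + w * x * z * S (k - 1)"
proof -
  have "\<not> 3 dvd 3 * k + 1" "\<not> 3 dvd 3 * k - 1" "\<not> 3 dvd 3 * k - 2" "3 dvd 3 * k - 3"
    and "(3 * k - 3) div 3 = k - 1"
    by presburger+
  then show ?thesis
    by (subst S_functional_equation) simp
qed

text \<open>The index of \<open>R (n + 1)\<close> has the form \<open>3 k + 1\<close> with \<open>k\<close> the index of \<open>R n\<close>,
  which is where the residues 0 and 1 modulo 3 enter.\<close>

lemma three_power_half_Suc: "((3::int) ^ Suc n - 1) div 2 = 3 * ((3 ^ n - 1) div 2) + 1"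
proof -
  have "odd ((3::int) ^ n)"
    by simp
  then obtain k where "(3::int) ^ n = 2 * k + 1"
    by (rule oddE)
  then show ?thesis
    by simp
qed

lemma Q_eq: "Q n = S ((3 ^ n - 1) div 2 - 1)"
proof -
  have "((3::int) ^ n - 3) div 2 = (3 ^ n - 1) div 2 - 1"
    by presburger
  then show ?thesis
    by (simp add: Q_def)
qed

lemma Q_Suc: "Q (Suc n) = R n + (w * x * y + w * z + x * z) * Q n"
proof -
  have "Q (Suc n) = S (3 * ((3 ^ n - 1) div 2))"
    by (simp add: Q_eq three_power_half_Suc del: power_Suc)
  then show ?thesis
    by (simp add: S_triple Q_eq R_def)
qed

lemma R_Suc: "R (Suc n) = (w + x + y) * R n + w * x * z * Q n"
proof -
  have "R (Suc n) = S (3 * ((3 ^ n - 1) div 2) + 1)"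
    by (simp add: R_def three_power_half_Suc del: power_Suc)
  then show ?thesis
    by (simp add: S_triple_plus_1 Q_eq R_def)
qed

text \<open>Cayley--Hamilton for a 2-by-2 matrix with rows \<open>(d, 1)\<close> and \<open>(e, a)\<close>, applied to a
  sequence of vectors in which each is the image of the previous one.\<close>

lemma linear_system_second_order_recurrence:
  fixes u v :: "nat \<Rightarrow> 'a::comm_ring_1"
  assumes u: "\<And>n. u (Suc n) = v n + d * u n" and v: "\<And>n. v (Suc n) = a * v n + e * u n"
  shows "u (Suc (Suc n)) = (a + d) * u (Suc n) - (a * d - e) * u n"
    and "v (Suc (Suc n)) = (a + d) * v (Suc n) - (a * d - e) * v n"
  by (simp_all add: u v algebra_simps)

theorem proposition3p1:
  shows "(Q 0 = 0 \<and> Q 1 = 1 \<and> (\<forall>n\<ge>2. Q n = W1 * Q (n - 1) - W2 * Q (n - 2))) \<and>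
         (R 0 = 1 \<and> R 1 = w + x + y \<and> (\<forall>n\<ge>2. R n = W1 * R (n - 1) - W2 * R (n - 2)))"
proof -
  have Q0: "Q 0 = 0"
    by (simp add: Q_def S_def)
  have R0: "R 0 = 1"
    using S_gf_nth [of 0 0] by (simp add: R_def S_def)
  have tr: "W1 = (w + x + y) + (w * x * y + w * z + x * z)"
    by (simp add: W1_def algebra_simps)
  have det: "W2 = (w + x + y) * (w * x * y + w * z + x * z) - w * x * z"
    by (simp add: W2_def algebra_simps power2_eq_square)
  have rec: "Q (Suc (Suc m)) = W1 * Q (Suc m) - W2 * Q m"
    "R (Suc (Suc m)) = W1 * R (Suc m) - W2 * R m" for m
    unfolding tr det
    by (rule linear_system_second_order_recurrence [where u = Q and v = R], rule Q_Suc, rule R_Suc)+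
  have "Q n = W1 * Q (n - 1) - W2 * Q (n - 2) \<and> R n = W1 * R (n - 1) - W2 * R (n - 2)"
    if "n \<ge> 2" for n
  proof -
    have "n = Suc (Suc (n - 2))" and "n - 1 = Suc (n - 2)"
      using that by simp_all
    then show ?thesis
      using rec [of "n - 2"] by metis
  qed
  then show ?thesis
    using Q0 R0 Q_Suc [of 0] R_Suc [of 0] by simp
qed

end
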